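(* Let $X$ and $Y$ be Banach spaces, and let $T\in\mathcal{L}(X,Y^* )$. Then the following are equivalent. (a) $T\in w^*\mathrm{QNA}(X,Y^* )$. (b) The biadjoint $T^{**}\in\mathcal{L}(X^{**},Y^{***})$ attains its norm at some $z^{**}\in S_{X^{**}}$ for which $\|(T^{**}z^{**})|_Y\|=\|T\|$, where $(T^{**}z^{**})|_Y\in Y^*$ denotes the restriction of the functional $T^{**}z^{**}\in Y^{***}$ to $Y$ (canonically embedded in $Y^{**}$).
   Context: Banach spaces are over $\mathbb{K}=\mathbb{R}$ or $\mathbb{C}$. $B_X$ and $S_X$ are the closed unit ball and unit sphere of $X$, $X^*$ is its topological dual, and $\mathcal{L}(X,Y)$ is the space of bounded linear operators from $X$ to $Y$ with the operator norm. An operator $T\in\mathcal{L}(X,Y^* )$ weak-star quasi attains its norm, written $T\in w^*\mathrm{QNA}(X,Y^* )$, if there exist a net $(x_\alpha)\subset B_X$ and $u^*\in Y^*$ with $\|u^*\|=\|T\|$ such that $Tx_\alpha\to u^*$ in the weak-star topology $\sigma(Y^*,Y)$; equivalently, the $\sigma(Y^*,Y)$-closure of $T(B_X)$ intersects the sphere $\{u^*\in Y^*:\|u^*\|=\|T\|\}$. An operator $R$ attains its norm at a point $z$ of the closed unit ball of its domain if $\|Rz\|=\|R\|$.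
   Formalization: X is assumed to be nonzero: for X = {0} and T = 0, (a) holds with u* = 0, while (b) fails because the unit sphere of X** is empty. *)

theory Defs
  imports "HOL-Analysis.Analysis"
begin

text \<open>
  The scalar field is \<open>\<real>\<close> or \<open>\<complex>\<close>.  The distribution only provides real normed spaces, with
  \<open>'a \<Rightarrow>\<^sub>L 'b\<close> as the space of bounded linear operators, so complex normed spaces and their bounded
  complex-linear operators are introduced here and every notion comes in a real and a complex
  version.  The dual of \<open>'a\<close> is \<open>'a \<Rightarrow>\<^sub>L real\<close>, respectively \<open>'a \<Rightarrow>\<^sub>C\<^sub>L complex\<close>.
\<close>


section \<open>Complex normed spaces\<close>

class complex_normed_vector = real_normed_vector +
  fixes scaleC :: "complex \<Rightarrow> 'a \<Rightarrow> 'a" (infixr "*\<^sub>C" 75)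
  assumes scaleC_add_right: "c *\<^sub>C (x + y) = c *\<^sub>C x + c *\<^sub>C y"
    and scaleC_add_left: "(c + d) *\<^sub>C x = c *\<^sub>C x + d *\<^sub>C x"
    and scaleC_scaleC: "c *\<^sub>C d *\<^sub>C x = (c * d) *\<^sub>C x"
    and scaleC_of_real: "complex_of_real r *\<^sub>C x = r *\<^sub>R x"
    and norm_scaleC: "norm (c *\<^sub>C x) = cmod c * norm x"

class complex_banach = complex_normed_vector + banach

instantiation complex :: complex_banach
begin

definition scaleC_complex :: "complex \<Rightarrow> complex \<Rightarrow> complex"
  where "scaleC_complex c x = c * x"

instance
  by standard
    (simp_all add: scaleC_complex_def algebra_simps norm_mult scaleR_conv_of_real)

end

typedef (overloaded) ('a, 'b) cblinfun ("(_ \<Rightarrow>\<^sub>C\<^sub>L /_)" [22, 21] 21) =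
  "{f :: 'a::complex_normed_vector \<Rightarrow>\<^sub>L 'b::complex_normed_vector.
      \<forall>c x. blinfun_apply f (c *\<^sub>C x) = c *\<^sub>C blinfun_apply f x}"
  morphisms blinfun_of_cblinfun cblinfun_of_blinfun
proof -
  have "c *\<^sub>C (0::'b) = 0" for c
    using norm_scaleC[of c "0::'b"] by simp
  then show ?thesis
    by (intro exI[of _ 0]) simp
qed

setup_lifting type_definition_cblinfun

lift_definition cblinfun_apply :: "('a::complex_normed_vector \<Rightarrow>\<^sub>C\<^sub>L 'b::complex_normed_vector) \<Rightarrow> 'a \<Rightarrow> 'b"
  is blinfun_apply .

declare [[coercion
  "cblinfun_apply :: ('a::complex_normed_vector \<Rightarrow>\<^sub>C\<^sub>L 'b::complex_normed_vector) \<Rightarrow> 'a \<Rightarrow> 'b"]]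

lemma scaleC_zero_right [simp]: "c *\<^sub>C (0::'a::complex_normed_vector) = 0"
  using norm_scaleC[of c "0::'a"] by simp

lemma scaleC_scaleR: "c *\<^sub>C r *\<^sub>R x = r *\<^sub>R c *\<^sub>C (x::'a::complex_normed_vector)"
  by (simp add: scaleC_of_real[symmetric] scaleC_scaleC mult.commute)

lemma scaleC_minus_right: "c *\<^sub>C (- x) = - (c *\<^sub>C (x::'a::complex_normed_vector))"
  using scaleC_scaleR[of c "-1" x] by simp

lemma scaleC_diff_right:
  "c *\<^sub>C (x - y) = c *\<^sub>C x - c *\<^sub>C (y::'a::complex_normed_vector)"
  using scaleC_add_right[of c x "- y"] by (simp add: scaleC_minus_right)

lemma bounded_linear_scaleC: "bounded_linear (\<lambda>x::'a::complex_normed_vector. c *\<^sub>C x)"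
  by (rule bounded_linear_intro[where K = "cmod c"])
    (simp_all add: scaleC_add_right scaleC_scaleR norm_scaleC mult.commute)

lemma cblinfun_eqI: "(\<And>x. cblinfun_apply f x = cblinfun_apply g x) \<Longrightarrow> f = g"
  by transfer (rule blinfun_eqI)

lemma cblinfun_apply_scaleC: "cblinfun_apply f (c *\<^sub>C x) = c *\<^sub>C cblinfun_apply f x"
  by transfer simp

instantiation cblinfun :: (complex_normed_vector, complex_normed_vector) complex_normed_vector
begin

text \<open>The norm is the operator norm, inherited from \<open>'a \<Rightarrow>\<^sub>L 'b\<close>.\<close>

lift_definition norm_cblinfun :: "'a \<Rightarrow>\<^sub>C\<^sub>L 'b \<Rightarrow> real" is norm .

lift_definition minus_cblinfun :: "'a \<Rightarrow>\<^sub>C\<^sub>L 'b \<Rightarrow> 'a \<Rightarrow>\<^sub>C\<^sub>L 'b \<Rightarrow> 'a \<Rightarrow>\<^sub>C\<^sub>L 'b" is minus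
  by (simp add: blinfun.diff_left scaleC_diff_right)

lift_definition uminus_cblinfun :: "'a \<Rightarrow>\<^sub>C\<^sub>L 'b \<Rightarrow> 'a \<Rightarrow>\<^sub>C\<^sub>L 'b" is uminus
  by (simp add: blinfun.minus_left scaleC_minus_right)

lift_definition zero_cblinfun :: "'a \<Rightarrow>\<^sub>C\<^sub>L 'b" is 0
  by simp

lift_definition plus_cblinfun :: "'a \<Rightarrow>\<^sub>C\<^sub>L 'b \<Rightarrow> 'a \<Rightarrow>\<^sub>C\<^sub>L 'b \<Rightarrow> 'a \<Rightarrow>\<^sub>C\<^sub>L 'b" is plus
  by (simp add: blinfun.add_left scaleC_add_right)

lift_definition scaleR_cblinfun :: "real \<Rightarrow> 'a \<Rightarrow>\<^sub>C\<^sub>L 'b \<Rightarrow> 'a \<Rightarrow>\<^sub>C\<^sub>L 'b" is scaleR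
  by (simp add: blinfun.scaleR_left scaleC_scaleR)

lift_definition scaleC_cblinfun :: "complex \<Rightarrow> 'a \<Rightarrow>\<^sub>C\<^sub>L 'b \<Rightarrow> 'a \<Rightarrow>\<^sub>C\<^sub>L 'b"
  is "\<lambda>c f. Blinfun (\<lambda>x. c *\<^sub>C blinfun_apply f x)"
  by (simp add: bounded_linear_Blinfun_apply scaleC_scaleC mult.commute
      bounded_linear_compose[OF bounded_linear_scaleC blinfun.bounded_linear_right])

definition dist_cblinfun :: "'a \<Rightarrow>\<^sub>C\<^sub>L 'b \<Rightarrow> 'a \<Rightarrow>\<^sub>C\<^sub>L 'b \<Rightarrow> real"
  where "dist_cblinfun f g = norm (f - g)"

definition
  "(uniformity :: (('a \<Rightarrow>\<^sub>C\<^sub>L 'b) \<times> ('a \<Rightarrow>\<^sub>C\<^sub>L 'b)) filter) =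
    (INF e\<in>{0<..}. principal {(f, g). dist f g < e})"

definition open_cblinfun :: "('a \<Rightarrow>\<^sub>C\<^sub>L 'b) set \<Rightarrow> bool"
  where "open_cblinfun S = (\<forall>f\<in>S. \<forall>\<^sub>F (f', g) in uniformity. f' = f \<longrightarrow> g \<in> S)"

definition sgn_cblinfun :: "'a \<Rightarrow>\<^sub>C\<^sub>L 'b \<Rightarrow> 'a \<Rightarrow>\<^sub>C\<^sub>L 'b"
  where "sgn_cblinfun f = scaleR (inverse (norm f)) f"

instance
proof
  have apply_scaleC: "blinfun_apply (Blinfun (\<lambda>x. c *\<^sub>C blinfun_apply f x)) y = c *\<^sub>C blinfun_apply f y"
    for c y and f :: "'a \<Rightarrow>\<^sub>L 'b"
    by (simp add: bounded_linear_Blinfun_apply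
        bounded_linear_compose[OF bounded_linear_scaleC blinfun.bounded_linear_right])
  fix f g h :: "'a \<Rightarrow>\<^sub>C\<^sub>L 'b" and r s :: real and c d :: complex
  show "f + g + h = f + (g + h)" "f + g = g + f" "0 + f = f" "- f + f = 0" "f - g = f + - g"
    by (transfer, simp)+
  show "r *\<^sub>R (f + g) = r *\<^sub>R f + r *\<^sub>R g" "(r + s) *\<^sub>R f = r *\<^sub>R f + s *\<^sub>R f"
    "r *\<^sub>R s *\<^sub>R f = (r * s) *\<^sub>R f" "1 *\<^sub>R f = f"
    by (transfer, simp add: algebra_simps)+
  show "norm f = 0 \<longleftrightarrow> f = 0" "norm (f + g) \<le> norm f + norm g" "norm (r *\<^sub>R f) = \<bar>r\<bar> * norm f"
    by (transfer, simp add: norm_triangle_ineq)+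
  show "dist f g = norm (f - g)"
    by (rule dist_cblinfun_def)
  show "sgn f = inverse (norm f) *\<^sub>R f"
    by (rule sgn_cblinfun_def)
  show "(uniformity :: (('a \<Rightarrow>\<^sub>C\<^sub>L 'b) \<times> ('a \<Rightarrow>\<^sub>C\<^sub>L 'b)) filter) =
      (INF e\<in>{0<..}. principal {(f, g). dist f g < e})"
    by (rule uniformity_cblinfun_def)
  show "open U = (\<forall>f\<in>U. \<forall>\<^sub>F (f', g) in uniformity. f' = f \<longrightarrow> g \<in> U)" for U :: "('a \<Rightarrow>\<^sub>C\<^sub>L 'b) set"
    by (rule open_cblinfun_def)
  show "c *\<^sub>C (f + g) = c *\<^sub>C f + c *\<^sub>C g"
    by transfer (rule blinfun_eqI, simp only: apply_scaleC,
        simp add: apply_scaleC blinfun.add_left scaleC_add_right)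
  show "(c + d) *\<^sub>C f = c *\<^sub>C f + d *\<^sub>C f"
    by transfer (rule blinfun_eqI, simp only: apply_scaleC,
        simp add: apply_scaleC blinfun.add_left scaleC_add_left)
  show "c *\<^sub>C d *\<^sub>C f = (c * d) *\<^sub>C f"
    by transfer (rule blinfun_eqI, simp add: apply_scaleC scaleC_scaleC)
  show "complex_of_real r *\<^sub>C f = r *\<^sub>R f"
    by transfer (rule blinfun_eqI, simp only: apply_scaleC,
        simp add: scaleC_of_real blinfun.scaleR_left)
  have le: "norm (c *\<^sub>C f) \<le> cmod c * norm f" for c and f :: "'a \<Rightarrow>\<^sub>C\<^sub>L 'b"
  proof transfer
    fix c and f :: "'a \<Rightarrow>\<^sub>L 'b"
    show "norm (Blinfun (\<lambda>x. c *\<^sub>C blinfun_apply f x)) \<le> cmod c * norm f"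
    proof (rule norm_blinfun_bound)
      fix x
      have "cmod c * norm (blinfun_apply f x) \<le> cmod c * (norm f * norm x)"
        by (intro mult_left_mono norm_blinfun) simp
      then show "norm (blinfun_apply (Blinfun (\<lambda>x. c *\<^sub>C blinfun_apply f x)) x)
          \<le> cmod c * norm f * norm x"
        by (simp add: bounded_linear_Blinfun_apply norm_scaleC mult.assoc
            bounded_linear_compose[OF bounded_linear_scaleC blinfun.bounded_linear_right])
    qed simp
  qed
  show "norm (c *\<^sub>C f) = cmod c * norm f"
  proof (cases "c = 0")
    case True
    moreover have "0 \<le> norm (c *\<^sub>C f)"
      by transfer simp
    ultimately show ?thesis
      using le[of c f] by simp
  next
    case False
    have "inverse c *\<^sub>C c *\<^sub>C f = f"
      using False
      by transfer (rule blinfun_eqI,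
        simp add: apply_scaleC scaleC_scaleC scaleC_of_real[of 1, simplified] blinfun_apply_inverse)
    then have "norm f \<le> inverse (cmod c) * norm (c *\<^sub>C f)"
      using le[of "inverse c" "c *\<^sub>C f"] by (simp add: norm_inverse)
    then have "cmod c * norm f \<le> norm (c *\<^sub>C f)"
      using False by (simp add: field_simps)
    with le[of c f] show ?thesis
      by simp
  qed
qed

end

lemma cblinfun_apply_add_left: "cblinfun_apply (f + g) x = cblinfun_apply f x + cblinfun_apply g x"
  by transfer (simp add: blinfun.add_left)

lemma cblinfun_apply_scaleC_left: "cblinfun_apply (c *\<^sub>C f) x = c *\<^sub>C cblinfun_apply f x"
  by transfer (simp add: bounded_linear_Blinfun_apply
      bounded_linear_compose[OF bounded_linear_scaleC blinfun.bounded_linear_right])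

lemma cblinfun_apply_scaleR_left: "cblinfun_apply (r *\<^sub>R f) x = r *\<^sub>R cblinfun_apply f x"
  by transfer (simp add: blinfun.scaleR_left)

lemma cblinfun_apply_add_right: "cblinfun_apply f (x + y) = cblinfun_apply f x + cblinfun_apply f y"
  by transfer (simp add: blinfun.add_right)

lemma cblinfun_apply_scaleR_right: "cblinfun_apply f (r *\<^sub>R x) = r *\<^sub>R cblinfun_apply f x"
  by transfer (simp add: blinfun.scaleR_right)

lemma norm_cblinfun: "norm (cblinfun_apply f x) \<le> norm f * norm x"
  by transfer (rule norm_blinfun)

lemma norm_cblinfun_bound:
  "0 \<le> b \<Longrightarrow> (\<And>x. norm (cblinfun_apply f x) \<le> b * norm x) \<Longrightarrow> norm f \<le> b"
  by transfer (rule norm_blinfun_bound)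

text \<open>The operator given by a function \<open>f\<close>; only meaningful if \<open>f\<close> is bounded and complex-linear.\<close>

definition CBlinfun :: "('a::complex_normed_vector \<Rightarrow> 'b::complex_normed_vector) \<Rightarrow> 'a \<Rightarrow>\<^sub>C\<^sub>L 'b"
  where "CBlinfun f = cblinfun_of_blinfun (Blinfun f)"

lemma cblinfun_apply_CBlinfun:
  assumes "bounded_linear f" "\<And>c x. f (c *\<^sub>C x) = c *\<^sub>C f x"
  shows "cblinfun_apply (CBlinfun f) = f"
  using assms
  by (simp add: CBlinfun_def cblinfun_apply.rep_eq cblinfun_of_blinfun_inverse
      bounded_linear_Blinfun_apply)

lift_definition cblinfun_compose ::
    "('b::complex_normed_vector \<Rightarrow>\<^sub>C\<^sub>L 'c::complex_normed_vector) \<Rightarrow>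
     ('a::complex_normed_vector \<Rightarrow>\<^sub>C\<^sub>L 'b) \<Rightarrow> 'a \<Rightarrow>\<^sub>C\<^sub>L 'c" (infixl "o\<^sub>C\<^sub>L" 55)
  is blinfun_compose
  by simp

lemma cblinfun_apply_compose [simp]:
  "cblinfun_apply (f o\<^sub>C\<^sub>L g) x = cblinfun_apply f (cblinfun_apply g x)"
  by transfer simp

lemma norm_cblinfun_compose: "norm (f o\<^sub>C\<^sub>L g) \<le> norm f * norm g"
  by transfer (rule norm_blinfun_compose)


section \<open>Adjoints and the canonical embedding into the bidual\<close>

definition adjointR ::
    "('a::real_normed_vector \<Rightarrow>\<^sub>L 'b::real_normed_vector) \<Rightarrow> ('b \<Rightarrow>\<^sub>L real) \<Rightarrow>\<^sub>L ('a \<Rightarrow>\<^sub>L real)"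
  where "adjointR T = Blinfun (\<lambda>\<phi>. \<phi> o\<^sub>L T)"

definition adjointC ::
    "('a::complex_normed_vector \<Rightarrow>\<^sub>C\<^sub>L 'b::complex_normed_vector) \<Rightarrow> ('b \<Rightarrow>\<^sub>C\<^sub>L complex) \<Rightarrow>\<^sub>C\<^sub>L ('a \<Rightarrow>\<^sub>C\<^sub>L complex)"
  where "adjointC T = CBlinfun (\<lambda>\<phi>. \<phi> o\<^sub>C\<^sub>L T)"

definition canonR :: "'a::real_normed_vector \<Rightarrow>\<^sub>L (('a \<Rightarrow>\<^sub>L real) \<Rightarrow>\<^sub>L real)"
  where "canonR = Blinfun (\<lambda>x. Blinfun (\<lambda>\<phi>. blinfun_apply \<phi> x))"

definition canonC :: "'a::complex_normed_vector \<Rightarrow>\<^sub>C\<^sub>L (('a \<Rightarrow>\<^sub>C\<^sub>L complex) \<Rightarrow>\<^sub>C\<^sub>L complex)"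
  where "canonC = CBlinfun (\<lambda>x. CBlinfun (\<lambda>\<phi>. cblinfun_apply \<phi> x))"

lemma adjointR_apply: "adjointR T \<phi> = \<phi> o\<^sub>L T"
  unfolding adjointR_def
  by (simp add: bounded_linear_Blinfun_apply
      bounded_bilinear.bounded_linear_left[OF bounded_bilinear_blinfun_compose])

lemma adjointC_apply: "adjointC T \<phi> = \<phi> o\<^sub>C\<^sub>L T"
proof -
  have "bounded_linear (\<lambda>\<phi> :: 'b \<Rightarrow>\<^sub>C\<^sub>L complex. \<phi> o\<^sub>C\<^sub>L T)"
    by (rule bounded_linear_intro[where K = "norm T"])
      (auto intro!: cblinfun_eqI norm_cblinfun_compose
        simp: cblinfun_apply_add_left cblinfun_apply_scaleR_left)
  moreover have "(c *\<^sub>C \<phi>) o\<^sub>C\<^sub>L T = c *\<^sub>C (\<phi> o\<^sub>C\<^sub>L T)" for c and \<phi> :: "'b \<Rightarrow>\<^sub>C\<^sub>L complex"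
    by (rule cblinfun_eqI) (simp add: cblinfun_apply_scaleC_left)
  ultimately show ?thesis
    unfolding adjointC_def by (simp add: cblinfun_apply_CBlinfun)
qed

lemma canonR_apply: "blinfun_apply (blinfun_apply canonR x) \<phi> = blinfun_apply \<phi> x"
proof -
  have app: "blinfun_apply (Blinfun (\<lambda>\<phi>. blinfun_apply \<phi> x)) = (\<lambda>\<phi>::'a \<Rightarrow>\<^sub>L real. blinfun_apply \<phi> x)" for x
    by (rule bounded_linear_Blinfun_apply) simp
  have "bounded_linear (\<lambda>x. Blinfun (\<lambda>\<phi>::'a \<Rightarrow>\<^sub>L real. blinfun_apply \<phi> x))"
  proof (rule bounded_linear_intro[where K = 1])
    show "norm (Blinfun (\<lambda>\<phi>::'a \<Rightarrow>\<^sub>L real. blinfun_apply \<phi> x)) \<le> norm x * 1" for x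
    proof (rule norm_blinfun_bound)
      show "norm (blinfun_apply (Blinfun (\<lambda>\<phi>. blinfun_apply \<phi> x)) \<phi>) \<le> norm x * 1 * norm \<phi>" for \<phi> :: "'a \<Rightarrow>\<^sub>L real"
        using norm_blinfun[of \<phi> x] by (simp add: app mult.commute)
    qed simp
  qed (rule blinfun_eqI, simp only: app blinfun.add_left blinfun.scaleR_left,
      simp only: blinfun.add_right blinfun.scaleR_right)+
  then show ?thesis
    unfolding canonR_def by (simp add: bounded_linear_Blinfun_apply app)
qed

lemma canonC_apply: "cblinfun_apply (cblinfun_apply canonC x) \<phi> = cblinfun_apply \<phi> x"
proof -
  have app: "cblinfun_apply (CBlinfun (\<lambda>\<phi>. cblinfun_apply \<phi> x))
      = (\<lambda>\<phi>::'a \<Rightarrow>\<^sub>C\<^sub>L complex. cblinfun_apply \<phi> x)" for x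
  proof (rule cblinfun_apply_CBlinfun)
    show "bounded_linear (\<lambda>\<phi>::'a \<Rightarrow>\<^sub>C\<^sub>L complex. cblinfun_apply \<phi> x)"
      by (rule bounded_linear_intro[where K = "norm x"])
        (simp_all add: cblinfun_apply_add_left cblinfun_apply_scaleR_left norm_cblinfun)
  qed (rule cblinfun_apply_scaleC_left)
  have "bounded_linear (\<lambda>x. CBlinfun (\<lambda>\<phi>::'a \<Rightarrow>\<^sub>C\<^sub>L complex. cblinfun_apply \<phi> x))"
  proof (rule bounded_linear_intro[where K = 1])
    show "norm (CBlinfun (\<lambda>\<phi>::'a \<Rightarrow>\<^sub>C\<^sub>L complex. cblinfun_apply \<phi> x)) \<le> norm x * 1" for x
    proof (rule norm_cblinfun_bound)
      show "norm (cblinfun_apply (CBlinfun (\<lambda>\<phi>. cblinfun_apply \<phi> x)) \<phi>) \<le> norm x * 1 * norm \<phi>"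
        for \<phi> :: "'a \<Rightarrow>\<^sub>C\<^sub>L complex"
        using norm_cblinfun[of \<phi> x] by (simp add: app mult.commute)
    qed simp
  qed (rule cblinfun_eqI, simp only: app cblinfun_apply_add_left cblinfun_apply_scaleR_left,
      simp only: cblinfun_apply_add_right cblinfun_apply_scaleR_right)+
  moreover have "CBlinfun (\<lambda>\<phi>::'a \<Rightarrow>\<^sub>C\<^sub>L complex. cblinfun_apply \<phi> (c *\<^sub>C x))
      = c *\<^sub>C CBlinfun (\<lambda>\<phi>. cblinfun_apply \<phi> x)" for c x
    by (rule cblinfun_eqI)
      (simp only: app cblinfun_apply_scaleC_left, simp only: cblinfun_apply_scaleC)
  ultimately show ?thesis
    unfolding canonC_def by (simp add: cblinfun_apply_CBlinfun app)
qed

text \<open>Restriction to \<open>'a\<close>, canonically embedded in its bidual, of a functional on the bidual.\<close>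

definition restrictR :: "((('a::real_normed_vector \<Rightarrow>\<^sub>L real) \<Rightarrow>\<^sub>L real) \<Rightarrow>\<^sub>L real) \<Rightarrow> 'a \<Rightarrow>\<^sub>L real"
  where "restrictR \<Phi> = \<Phi> o\<^sub>L canonR"

definition restrictC ::
    "((('a::complex_normed_vector \<Rightarrow>\<^sub>C\<^sub>L complex) \<Rightarrow>\<^sub>C\<^sub>L complex) \<Rightarrow>\<^sub>C\<^sub>L complex) \<Rightarrow> 'a \<Rightarrow>\<^sub>C\<^sub>L complex"
  where "restrictC \<Phi> = \<Phi> o\<^sub>C\<^sub>L canonC"


section \<open>Norm attainment and weak-star quasi norm attainment\<close>

definition attains_norm_atR ::
    "('a::real_normed_vector \<Rightarrow>\<^sub>L 'b::real_normed_vector) \<Rightarrow> 'a \<Rightarrow> bool"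
  where "attains_norm_atR R z \<longleftrightarrow> z \<in> cball 0 1 \<and> norm (R z) = norm R"

definition attains_norm_atC ::
    "('a::complex_normed_vector \<Rightarrow>\<^sub>C\<^sub>L 'b::complex_normed_vector) \<Rightarrow> 'a \<Rightarrow> bool"
  where "attains_norm_atC R z \<longleftrightarrow> z \<in> cball 0 1 \<and> norm (R z) = norm R"

text \<open>
  The weak-star topology is the topology of pointwise convergence: the type \<open>'b \<Rightarrow> real\<close>
  (\<open>'b \<Rightarrow> complex\<close>) carries the product topology.
\<close>

definition weak_starR :: "('b::real_normed_vector \<Rightarrow>\<^sub>L real) topology"
  where "weak_starR = pullback_topology UNIV blinfun_apply euclidean"

definition weak_starC :: "('b::complex_normed_vector \<Rightarrow>\<^sub>C\<^sub>L complex) topology"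
  where "weak_starC = pullback_topology UNIV cblinfun_apply euclidean"

text \<open>
  A net in the unit ball is represented by its tail filter, a proper filter on the domain;
  \<open>F \<le> principal (cball 0 1)\<close> says that \<open>F\<close> lives on the closed unit ball.
\<close>

definition wstar_QNA_R :: "('a::real_normed_vector \<Rightarrow>\<^sub>L ('b::real_normed_vector \<Rightarrow>\<^sub>L real)) set"
  where "wstar_QNA_R = {T. \<exists>F u. F \<noteq> bot \<and> F \<le> principal (cball 0 1) \<and>
    norm u = norm T \<and> limitin weak_starR (blinfun_apply T) u F}"

definition wstar_QNA_C :: "('a::complex_normed_vector \<Rightarrow>\<^sub>C\<^sub>L ('b::complex_normed_vector \<Rightarrow>\<^sub>C\<^sub>L complex)) set"
  where "wstar_QNA_C = {T. \<exists>F u. F \<noteq> bot \<and> F \<le> principal (cball 0 1) \<and>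
    norm u = norm T \<and> limitin weak_starC (cblinfun_apply T) u F}"

lemma in_closure_of_image_iff_limitin:
  "u \<in> X closure_of (f ` B) \<longleftrightarrow> (\<exists>F. F \<noteq> bot \<and> F \<le> principal B \<and> limitin X f u F)"
proof
  assume u: "u \<in> X closure_of (f ` B)"
  define N where "N = {U. openin X U \<and> u \<in> U}"
  define F where "F = (INF U\<in>N. principal {x \<in> B. f x \<in> U})"
  have N: "topspace X \<in> N"
    using u by (auto simp: N_def in_closure_of)
  have ev: "eventually P F \<longleftrightarrow> (\<exists>U\<in>N. eventually P (principal {x \<in> B. f x \<in> U}))" for P
    unfolding F_def
  proof (rule eventually_INF_base)
    show "\<exists>W\<in>N. principal {x \<in> B. f x \<in> W} \<le> inf (principal {x \<in> B. f x \<in> U}) (principal {x \<in> B. f x \<in> V})"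
      if "U \<in> N" "V \<in> N" for U V
      using that by (intro bexI[of _ "U \<inter> V"]) (auto simp: N_def)
  qed (use N in blast)
  have "F \<noteq> bot"
    using u by (fastforce simp: trivial_limit_def ev eventually_principal N_def in_closure_of)
  moreover have "F \<le> principal B"
    using N by (auto simp: le_principal ev eventually_principal)
  moreover have "limitin X f u F"
    using u by (auto simp: limitin_def ev eventually_principal N_def in_closure_of)
  ultimately show "\<exists>F. F \<noteq> bot \<and> F \<le> principal B \<and> limitin X f u F"
    by blast
next
  assume "\<exists>F. F \<noteq> bot \<and> F \<le> principal B \<and> limitin X f u F"
  then obtain F where F: "F \<noteq> bot" "eventually (\<lambda>x. x \<in> B) F" "limitin X f u F"
    by (auto simp: le_principal)
  show "u \<in> X closure_of (f ` B)"
    unfolding in_closure_of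
  proof (intro conjI allI impI)
    show "u \<in> topspace X"
      using F(3) by (rule limitin_topspace)
    fix U assume "u \<in> U \<and> openin X U"
    then have "eventually (\<lambda>x. x \<in> B \<and> f x \<in> U) F"
      using F by (auto simp: limitin_def intro: eventually_conj)
    then show "\<exists>y. y \<in> f ` B \<and> y \<in> U"
      using F(1) eventually_happens' by blast
  qed
qed

lemma wstar_QNA_R_iff_closure:
  "T \<in> wstar_QNA_R \<longleftrightarrow>
    weak_starR closure_of (blinfun_apply T ` cball 0 1) \<inter> {u. norm u = norm T} \<noteq> {}"
  unfolding wstar_QNA_R_def
  by (auto simp: in_closure_of_image_iff_limitin disjoint_iff)

lemma wstar_QNA_C_iff_closure:
  "T \<in> wstar_QNA_C \<longleftrightarrow>
    weak_starC closure_of (cblinfun_apply T ` cball 0 1) \<inter> {u. norm u = norm T} \<noteq> {}"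
  unfolding wstar_QNA_C_def
  by (auto simp: in_closure_of_image_iff_limitin disjoint_iff)

end

theory Submission
  imports Defs
begin

text \<open>
  For \<open>z\<close> in the bidual, the restriction of \<open>T\<^sup>*\<^sup>*z\<close> to \<open>Y\<close> is \<open>y \<mapsto> z (T\<^sup>* y)\<close>.
  Hence, if a net \<open>x\<^sub>\<alpha>\<close> in the unit ball has \<open>z\<close> as its weak-star limit in \<open>X\<^sup>*\<^sup>*\<close>, then
  \<open>T x\<^sub>\<alpha>\<close> converges weak-star to this restriction.  By Banach-Alaoglu every net in the ball has
  such a subnet, and by Goldstine every \<open>z\<close> in the ball of the bidual arises in this way.  The rest is
  \<open>\<parallel>T\<parallel> = \<parallel>(T\<^sup>*\<^sup>*z)|\<^sub>Y\<parallel> \<le> \<parallel>T\<^sup>*\<^sup>*z\<parallel> \<le> \<parallel>T\<^sup>*\<^sup>*\<parallel> \<parallel>z\<parallel> \<le> \<parallel>T\<parallel> \<parallel>z\<parallel>\<close>, which forces \<open>\<parallel>z\<parallel> = 1\<close>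
  unless \<open>T = 0\<close>; in that case any unit vector of the bidual will do, and one exists by Hahn-Banach.
\<close>

section \<open>Hahn-Banach through minimal sublinear functionals\<close>

section \<open>Nonzero functionals\<close>

text \<open>Homogeneity is asked only as an inequality for \<open>c > 0\<close>, which passes to
  infima directly; applied to \<open>inverse c\<close> it yields equality.\<close>

definition sublinear :: "('a::real_vector \<Rightarrow> real) \<Rightarrow> bool"
  where "sublinear p \<longleftrightarrow> (\<forall>x y. p (x + y) \<le> p x + p y) \<and> (\<forall>c>0. \<forall>x. p (c *\<^sub>R x) \<le> c * p x)"

lemma sublinear_add: "sublinear p \<Longrightarrow> p (x + y) \<le> p x + p y"
  by (simp add: sublinear_def)

lemma sublinear_scaleR:
  assumes "sublinear p" "0 \<le> c"
  shows "p (c *\<^sub>R x) = c * p x"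
proof (cases "c = 0")
  case True
  have "p 0 \<le> p 0 + p 0"
    using assms(1) sublinear_add[of p 0 0] by simp
  moreover have "p ((1/2) *\<^sub>R 0) \<le> (1/2) * p 0"
    using assms(1) unfolding sublinear_def by (metis half_gt_zero zero_less_one)
  ultimately show ?thesis
    using True by simp
next
  case False
  with assms have c: "c > 0" by simp
  then have "p (c *\<^sub>R x) \<le> c * p x"
    using assms(1) by (simp add: sublinear_def)
  moreover have "p (inverse c *\<^sub>R (c *\<^sub>R x)) \<le> inverse c * p (c *\<^sub>R x)"
    using assms(1) c unfolding sublinear_def by (metis positive_imp_inverse_positive)
  then have "c * p x \<le> p (c *\<^sub>R x)"
    using c by (simp add: field_simps)
  ultimately show ?thesis by simp
qed

lemma sublinear_minus:
  assumes "sublinear p"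
  shows "- p (- x) \<le> p x"
  using sublinear_add[OF assms, of x "- x"] sublinear_scaleR[OF assms, of 0 0] by simp

text \<open>For sublinear \<open>p\<close> this is the largest sublinear functional below
  \<open>p\<close> whose value at \<open>- y\<close> is at most \<open>- p y\<close>.\<close>

definition shift_inf :: "('a::real_vector \<Rightarrow> real) \<Rightarrow> 'a \<Rightarrow> 'a \<Rightarrow> real"
  where "shift_inf p y x = (INF t\<in>{0..}. p (x + t *\<^sub>R y) - t * p y)"

lemma shift_inf_le:
  assumes "sublinear p" "0 \<le> t"
  shows "shift_inf p y x \<le> p (x + t *\<^sub>R y) - t * p y"
  unfolding shift_inf_def
proof (rule cINF_lower)
  show "bdd_below ((\<lambda>t. p (x + t *\<^sub>R y) - t * p y) ` {0..})"
  proof (rule bdd_belowI2)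
    \<comment> \<open>The bound comes from \<open>t * p y = p (t *\<^sub>R y) \<le> p (x + t
      *\<^sub>R y) + p (- x)\<close>.\<close>
    fix t :: real assume "t \<in> {0..}"
    then have "p (t *\<^sub>R y) = t * p y"
      using sublinear_scaleR[OF assms(1)] by simp
    then show "- p (- x) \<le> p (x + t *\<^sub>R y) - t * p y"
      using sublinear_add[OF assms(1), of "x + t *\<^sub>R y" "- x"] by simp
  qed
qed (use assms in auto)

lemma shift_inf_greatest:
  "(\<And>t. 0 \<le> t \<Longrightarrow> b \<le> p (x + t *\<^sub>R y) - t * p y) \<Longrightarrow> b \<le> shift_inf p y x"
  unfolding shift_inf_def by (rule cINF_greatest) auto

text \<open>Parameters \<open>s\<close> and \<open>t\<close> for the summands combine to
  \<open>s + t\<close> for the sum, and \<open>t\<close> for \<open>x\<close> becomes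
  \<open>c * t\<close> for \<open>c *\<^sub>R x\<close>; the infima are then taken one variable at a
  time.\<close>

lemma sublinear_shift_inf:
  assumes "sublinear p"
  shows "sublinear (shift_inf p y)"
  unfolding sublinear_def
proof (intro conjI allI impI)
  fix x x'
  have le: "shift_inf p y (x + x') \<le> (p (x + s *\<^sub>R y) - s * p y) + (p (x' + t *\<^sub>R y) - t * p y)"
    if "0 \<le> s" "0 \<le> t" for s t
    using shift_inf_le[OF assms, of "s + t" y "x + x'"] that
      sublinear_add[OF assms, of "x + s *\<^sub>R y" "x' + t *\<^sub>R y"]
    by (simp add: algebra_simps)
  have "shift_inf p y (x + x') - (p (x' + t *\<^sub>R y) - t * p y) \<le> shift_inf p y x" if "0 \<le> t" for t
    by (rule shift_inf_greatest) (use le that in force)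
  then have "shift_inf p y (x + x') - shift_inf p y x \<le> shift_inf p y x'"
    by (intro shift_inf_greatest) force
  then show "shift_inf p y (x + x') \<le> shift_inf p y x + shift_inf p y x'"
    by simp
next
  fix c :: real and x assume c: "0 < c"
  have "shift_inf p y (c *\<^sub>R x) / c \<le> shift_inf p y x"
  proof (rule shift_inf_greatest)
    fix t :: real assume "0 \<le> t"
    then have "shift_inf p y (c *\<^sub>R x) \<le> p (c *\<^sub>R (x + t *\<^sub>R y)) - (c * t) * p y"
      using shift_inf_le[OF assms, of "c * t" y "c *\<^sub>R x"] c by (simp add: algebra_simps)
    also have "\<dots> = c * (p (x + t *\<^sub>R y) - t * p y)"
      using sublinear_scaleR[OF assms, of c "x + t *\<^sub>R y"] c by (simp add: algebra_simps)
    finally show "shift_inf p y (c *\<^sub>R x) / c \<le> p (x + t *\<^sub>R y) - t * p y"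
      using c by (simp add: field_simps)
  qed
  then show "shift_inf p y (c *\<^sub>R x) \<le> c * shift_inf p y x"
    using c by (simp add: field_simps)
qed

text \<open>Zorn's lemma for the reversed pointwise order. The infimum of a nonempty chain is finite
  because every sublinear functional below \<open>p\<close> is bounded below by
  \<open>- p (- x)\<close>.\<close>

lemma exists_minimal_sublinear:
  assumes p: "sublinear p"
  obtains q where "sublinear q" "\<And>x. q x \<le> p x"
    "\<And>r. sublinear r \<Longrightarrow> (\<And>x. r x \<le> q x) \<Longrightarrow> r = q"
proof -
  define A where "A = {q. sublinear q \<and> q \<le> p}"
  have "\<exists>m\<in>A. \<forall>a\<in>A. a \<le> m \<longrightarrow> a = m"
  proof (rule predicate_Zorn)
    show "partial_order_on A (relation_of (\<lambda>q r. r \<le> q) A)"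
      by (rule partial_order_on_relation_ofI) auto
    fix C assume C: "C \<in> Chains (relation_of (\<lambda>q r. r \<le> q) A)"
    then have CA: "sublinear q" "q x \<le> p x" if "q \<in> C" for q x
      using Chains_relation_of[OF C] that by (auto simp: A_def le_fun_def)
    have tot: "q \<le> r \<or> r \<le> q" if "q \<in> C" "r \<in> C" for q r
      using C that by (auto simp: Chains_def relation_of_def)
    show "\<exists>u\<in>A. \<forall>a\<in>C. u \<le> a"
    proof (cases "C = {}")
      case True
      then show ?thesis using p by (auto simp: A_def)
    next
      case False
      define m where "m x = (INF q\<in>C. q x)" for x
      have lower: "m x \<le> q x" if "q \<in> C" for q x
        unfolding m_def
      proof (rule cINF_lower[OF _ that], rule bdd_belowI2)
        fix r assume "r \<in> C"
        then show "- p (- x) \<le> r x"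
          using sublinear_minus[OF CA(1), of r x] CA(2)[of r "- x"] by simp
      qed
      have greatest: "b \<le> m x" if "\<And>q. q \<in> C \<Longrightarrow> b \<le> q x" for b x
        unfolding m_def using False that by (rule cINF_greatest)
      have "sublinear m"
        unfolding sublinear_def
      proof (intro conjI allI impI)
        fix x y
        \<comment> \<open>The smaller of \<open>q\<close> and \<open>r\<close> in the chain lies
          below both, so its subadditivity serves both summands.\<close>
        have le: "m (x + y) \<le> q x + r y" if qr: "q \<in> C" "r \<in> C" for q r
        proof -
          obtain s where s: "s \<in> C" "s \<le> q" "s \<le> r"
            using tot[OF qr] qr by auto
          have "m (x + y) \<le> s x + s y"
            using lower[OF s(1), of "x + y"] sublinear_add[OF CA(1)[OF s(1)], of x y] by simp
          then show ?thesis
            using le_funD[OF s(2), of x] le_funD[OF s(3), of y] by simp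
        qed
        have "m (x + y) - r y \<le> m x" if "r \<in> C" for r
          by (rule greatest) (use le that in force)
        then have "m (x + y) - m x \<le> m y"
          by (intro greatest) force
        then show "m (x + y) \<le> m x + m y" by simp
      next
        fix c :: real and x assume c: "0 < c"
        have "m (c *\<^sub>R x) / c \<le> m x"
        proof (rule greatest)
          fix q assume q: "q \<in> C"
          then show "m (c *\<^sub>R x) / c \<le> q x"
            using lower[OF q, of "c *\<^sub>R x"] sublinear_scaleR[OF CA(1)[OF q], of c x] c
            by (simp add: field_simps)
        qed
        then show "m (c *\<^sub>R x) \<le> c * m x"
          using c by (simp add: field_simps)
      qed
      moreover have "m \<le> p"
        using False lower CA(2) by (fastforce simp: le_fun_def intro: order_trans)
      ultimately show ?thesis
        using lower by (auto simp: A_def le_fun_def)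
    qed
  qed
  then obtain q where q: "q \<in> A" "\<And>r. r \<in> A \<Longrightarrow> r \<le> q \<Longrightarrow> r = q"
    by blast
  show ?thesis
  proof
    show "sublinear q" "q x \<le> p x" for x
      using q(1) by (auto simp: A_def le_fun_def)
    show "r = q" if "sublinear r" "\<And>x. r x \<le> q x" for r
      using q that by (intro q(2)) (auto simp: A_def le_fun_def intro: order_trans)
  qed
qed

text \<open>A minimal sublinear \<open>q\<close> equals \<open>shift_inf q y\<close>, which gives \<open>q x + q y \<le> q (x + y)\<close>.\<close>

lemma exists_linear_le_sublinear:
  assumes "sublinear p"
  obtains f where "linear f" "\<And>x. f x \<le> p x"
proof -
  obtain q where q: "sublinear q" "\<And>x. q x \<le> p x"
    and min: "\<And>r. sublinear r \<Longrightarrow> (\<And>x. r x \<le> q x) \<Longrightarrow> r = q"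
    using exists_minimal_sublinear[OF assms] by blast
  have "shift_inf q y = q" for y
    using sublinear_shift_inf[OF q(1)] shift_inf_le[OF q(1), of 0]
    by (intro min) auto
  then have "q x + q y \<le> q (x + y)" for x y
    using shift_inf_le[OF q(1), of 1 y x] by simp
  then have add: "q (x + y) = q x + q y" for x y
    using sublinear_add[OF q(1)] by (intro antisym) auto
  have minus: "q (- x) = - q x" for x
    using add[of x "- x"] sublinear_scaleR[OF q(1), of 0 0] by simp
  have "q (c *\<^sub>R x) = c *\<^sub>R q x" for c x
    using sublinear_scaleR[OF q(1), of c x] sublinear_scaleR[OF q(1), of "- c" x] minus[of "c *\<^sub>R x"]
    by (cases "0 \<le> c") auto
  with add have "linear q"
    by (intro linearI)
  with q(2) show ?thesis
    using that by blast
qed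

text \<open>
  Replacing the norm by \<open>shift_inf norm x0\<close> pushes its value at \<open>- x0\<close> down to \<open>- norm x0\<close>, so every
  linear functional below it is norming at \<open>x0\<close>.
\<close>

lemma exists_norming_functional:
  fixes x0 :: "'a::real_normed_vector"
  obtains f :: "'a \<Rightarrow>\<^sub>L real" where "norm f \<le> 1" "f x0 = norm x0"
proof -
  have sub: "sublinear (norm :: 'a \<Rightarrow> real)"
    by (auto simp: sublinear_def norm_triangle_ineq)
  obtain f where f: "linear f" "\<And>x. f x \<le> shift_inf norm x0 x"
    using exists_linear_le_sublinear[OF sublinear_shift_inf[OF sub]] by blast
  have le: "f x \<le> norm x" for x
    using f(2)[of x] shift_inf_le[OF sub, of 0 x0 x] by simp
  have abs: "\<bar>f x\<bar> \<le> norm x" for x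
    using le[of x] le[of "- x"] linear_neg[OF f(1), of x] by simp
  have "bounded_linear f"
    using f(1) abs by (intro bounded_linear_intro[where K = 1]) (auto simp: linear_add linear_cmul)
  then have app: "blinfun_apply (Blinfun f) = f"
    by (rule bounded_linear_Blinfun_apply)
  have "norm (Blinfun f) \<le> 1"
    using abs by (intro norm_blinfun_bound) (auto simp: app)
  moreover have "f (- x0) \<le> - norm x0"
    using f(2)[of "- x0"] shift_inf_le[OF sub, of 1 x0 "- x0"] by simp
  then have "f x0 = norm x0"
    using le[of x0] linear_neg[OF f(1), of x0] by simp
  ultimately show ?thesis
    using that by (simp add: app)
qed

text \<open>A real functional \<open>g\<close> with \<open>g x0 = norm x0\<close> is complexified to
  \<open>g x - \<i> g (\<i> x)\<close>; its real part is \<open>g\<close>, so it does not vanish at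
  \<open>x0\<close>.\<close>

lemma exists_functional_nonzeroC:
  fixes x0 :: "'a::complex_normed_vector"
  assumes "x0 \<noteq> 0"
  obtains f :: "'a \<Rightarrow>\<^sub>C\<^sub>L complex" where "f x0 \<noteq> 0"
proof -
  obtain g :: "'a \<Rightarrow>\<^sub>L real" where g: "norm g \<le> 1" "g x0 = norm x0"
    using exists_norming_functional by blast
  define h where "h x = Complex (g x) (- g (\<i> *\<^sub>C x))" for x
  have scale_ii: "g (\<i> *\<^sub>C c *\<^sub>C x) = Re c * g (\<i> *\<^sub>C x) - Im c * g x" for c x
  proof -
    have "\<i> * c = complex_of_real (Re c) * \<i> + complex_of_real (- Im c)"
      by (simp add: complex_eq_iff)
    then have "\<i> *\<^sub>C c *\<^sub>C x = Re c *\<^sub>R \<i> *\<^sub>C x + (- Im c) *\<^sub>R x"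
      by (metis scaleC_scaleC scaleC_add_left scaleC_of_real)
    then show ?thesis
      by (simp only: blinfun.add_right blinfun.scaleR_right) simp
  qed
  have scale: "g (c *\<^sub>C x) = Re c * g x + Im c * g (\<i> *\<^sub>C x)" for c x
  proof -
    have "c = complex_of_real (Re c) + complex_of_real (Im c) * \<i>"
      by (simp add: complex_eq_iff)
    then have "c *\<^sub>C x = Re c *\<^sub>R x + Im c *\<^sub>R \<i> *\<^sub>C x"
      by (metis scaleC_scaleC scaleC_add_left scaleC_of_real)
    then show ?thesis
      by (simp only: blinfun.add_right blinfun.scaleR_right) simp
  qed
  have bl: "bounded_linear h"
  proof (rule bounded_linear_intro[where K = "2 * norm g"])
    show "h (x + y) = h x + h y" for x y
      by (simp add: h_def scaleC_add_right blinfun.add_right complex_eq_iff)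
    show "h (r *\<^sub>R x) = r *\<^sub>R h x" for r x
      by (simp add: h_def scaleC_scaleR blinfun.scaleR_right complex_eq_iff)
    show "norm (h x) \<le> norm x * (2 * norm g)" for x
      using cmod_le[of "h x"] norm_blinfun[of g x] norm_blinfun[of g "\<i> *\<^sub>C x"]
      by (simp add: h_def norm_scaleC mult.commute)
  qed
  have "h (c *\<^sub>C x) = c *\<^sub>C h x" for c x
    by (simp add: h_def scale[of c x] scale_ii[of c x] scaleC_complex_def complex_eq_iff)
  then have "cblinfun_apply (CBlinfun h) x0 = h x0"
    using bl by (simp add: cblinfun_apply_CBlinfun)
  moreover have "h x0 \<noteq> 0"
    using g(2) assms by (simp add: h_def complex_eq_iff)
  ultimately show ?thesis
    using that by metis
qed


section \<open>Banach-Alaoglu, and weak-star limits as pointwise limits\<close>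

section \<open>Weak-star compactness\<close>

text \<open>Tychonoff: the functions \<open>e x\<close> eventually lie in a compact product, so
  their image filter has a cluster point \<open>g\<close>. The subnet refines \<open>F\<close> by
  the preimages of neighbourhoods of \<open>g\<close>.\<close>

lemma pointwise_cluster_point:
  fixes e :: "'a \<Rightarrow> 'f \<Rightarrow> 'k::heine_borel" and K :: "'f \<Rightarrow> 'k set"
  assumes "F \<noteq> bot" "\<And>f. compact (K f)" "eventually (\<lambda>x. \<forall>f. e x f \<in> K f) F"
  obtains G g where "G \<noteq> bot" "G \<le> F" "\<And>f. ((\<lambda>x. e x f) \<longlongrightarrow> g f) G"
proof -
  have "compactin (product_topology (\<lambda>_. euclidean) UNIV) (PiE UNIV K)"
    using assms(2) by (simp add: compactin_PiE)
  then have "compact (PiE UNIV K)"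
    by (simp add: euclidean_product_topology)
  moreover have "filtermap e F \<noteq> bot" "eventually (\<lambda>h. h \<in> PiE UNIV K) (filtermap e F)"
    using assms by (auto simp: filtermap_bot_iff eventually_filtermap PiE_UNIV_domain Pi_iff)
  ultimately obtain g where g: "inf (nhds g) (filtermap e F) \<noteq> bot"
    unfolding compact_filter by blast
  define G where "G = inf (filtercomap e (nhds g)) F"
  have lim: "filterlim e (nhds g) G"
    by (simp add: G_def filterlim_iff_le_filtercomap)
  show ?thesis
  proof
    show "G \<le> F" by (simp add: G_def)
    show "G \<noteq> bot"
    proof
      \<comment> \<open>A trivial meet would yield a neighbourhood of \<open>g\<close> that
        \<open>e x\<close> eventually avoids along \<open>F\<close>.\<close>
      assume "G = bot"
      then obtain P Q where PQ: "eventually P (nhds g)" "eventually Q F" "\<And>x. P (e x) \<Longrightarrow> \<not> Q x"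
        unfolding G_def trivial_limit_def eventually_inf eventually_filtercomap by blast
      from PQ(2,3) have "eventually (\<lambda>h. \<not> P h) (filtermap e F)"
        unfolding eventually_filtermap by (auto elim: eventually_mono)
      with PQ(1) have "eventually (\<lambda>h. False) (inf (nhds g) (filtermap e F))"
        unfolding eventually_inf by blast
      with g show False by (simp add: trivial_limit_def)
    qed
    show "((\<lambda>x. e x f) \<longlongrightarrow> g f) G" for f
      using lim by (rule continuous_on_tendsto_compose[OF continuous_on_product_coordinates]) auto
  qed
qed

text \<open>With \<open>app\<close> the evaluation of functionals this covers
  \<open>weak_starR\<close> and \<open>weak_starC\<close> at once.\<close>

lemma limitin_pullback_pointwise_iff:
  fixes app :: "'c \<Rightarrow> 'b \<Rightarrow> 'k::topological_space"
  shows "limitin (pullback_topology UNIV app euclidean) h u F \<longleftrightarrow>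
    (\<forall>y. ((\<lambda>x. app (h x) y) \<longlongrightarrow> app u y) F)"
proof -
  have "limitin (pullback_topology UNIV app euclidean) h u F \<longleftrightarrow>
      limitin (product_topology (\<lambda>_. euclidean) UNIV) (\<lambda>x. app (h x)) (app u) F"
    by (auto simp: limitin_def openin_pullback_topology topspace_pullback_topology
        euclidean_product_topology)
  then show ?thesis
    by (simp add: limitin_componentwise)
qed

text \<open>The sets of \<open>e\<close>-approximants on finite \<open>I\<close> are nonempty by
  assumption and directed under enlarging \<open>I\<close> and shrinking \<open>e\<close>, so they
  generate a proper filter; this turns approximation into a net.\<close>

lemma exists_filter_pointwise_limit:
  fixes h :: "'a \<Rightarrow> 'b \<Rightarrow> 'k::metric_space"
  assumes "\<And>I e. finite I \<Longrightarrow> 0 < e \<Longrightarrow> \<exists>x\<in>B. \<forall>i\<in>I. dist (h x i) (l i) < e"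
  shows "\<exists>F. F \<noteq> bot \<and> F \<le> principal B \<and> (\<forall>i. ((\<lambda>x. h x i) \<longlongrightarrow> l i) F)"
proof -
  define N where "N = {I::'b set. finite I} \<times> {e::real. 0 < e}"
  define A where "A = (\<lambda>(I, e). {x \<in> B. \<forall>i\<in>I. dist (h x i) (l i) < e})"
  define F where "F = (INF p\<in>N. principal (A p))"
  have ev: "eventually P F \<longleftrightarrow> (\<exists>p\<in>N. eventually P (principal (A p)))" for P
    unfolding F_def
  proof (rule eventually_INF_base)
    show "N \<noteq> {}" by (auto simp: N_def intro: exI[of _ 1])
    fix p q assume "p \<in> N" "q \<in> N"
    then show "\<exists>r\<in>N. principal (A r) \<le> inf (principal (A p)) (principal (A q))"
      by (intro bexI[of _ "(fst p \<union> fst q, min (snd p) (snd q))"]) (auto simp: N_def A_def)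
  qed
  show ?thesis
  proof (intro exI[of _ F] conjI allI)
    show "F \<noteq> bot"
      using assms by (fastforce simp: trivial_limit_def ev eventually_principal N_def A_def)
    show "F \<le> principal B"
      unfolding le_principal ev eventually_principal
      by (intro bexI[of _ "({}, 1)"]) (auto simp: N_def A_def)
    show "((\<lambda>x. h x i) \<longlongrightarrow> l i) F" for i
    proof (rule tendstoI)
      fix e :: real assume "0 < e"
      then show "\<forall>\<^sub>F x in F. dist (h x i) (l i) < e"
        unfolding ev eventually_principal
        by (intro bexI[of _ "({i}, e)"]) (auto simp: N_def A_def)
    qed
  qed
qed

text \<open>Banach-Alaoglu: evaluation at a point of the unit ball sends \<open>f\<close> into the
  compact ball of radius \<open>norm f\<close>, so a subnet converges at every \<open>f\<close>. The
  limit inherits linearity and the bound.\<close>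

lemma bidual_cluster_pointR:
  fixes F :: "'a::real_normed_vector filter"
  assumes "F \<noteq> bot" "F \<le> principal (cball 0 1)"
  obtains G and z :: "('a \<Rightarrow>\<^sub>L real) \<Rightarrow>\<^sub>L real" where "G \<noteq> bot" "G \<le> F" "norm z \<le> 1"
    "\<And>f. ((\<lambda>x. blinfun_apply f x) \<longlongrightarrow> z f) G"
proof -
  have F: "eventually (\<lambda>x. norm x \<le> 1) F"
    using assms(2) by (simp add: le_principal)
  have bd: "norm (blinfun_apply f x) \<le> norm f" if "norm x \<le> 1" for f :: "'a \<Rightarrow>\<^sub>L real" and x
    using norm_blinfun[of f x] mult_left_le[OF that norm_ge_zero[of f]] by linarith
  have "eventually (\<lambda>x. \<forall>f::'a \<Rightarrow>\<^sub>L real. blinfun_apply f x \<in> cball 0 (norm f)) F"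
    using F by eventually_elim (use bd in auto)
  then obtain G g where G: "G \<noteq> bot" "G \<le> F"
      and lim: "\<And>f::'a \<Rightarrow>\<^sub>L real. ((\<lambda>x. blinfun_apply f x) \<longlongrightarrow> g f) G"
    using pointwise_cluster_point[OF assms(1), of "\<lambda>f::'a \<Rightarrow>\<^sub>L real. cball 0 (norm f)" "\<lambda>x f. blinfun_apply f x"]
    by auto
  have le: "norm (g f) \<le> norm f" for f
    using tendsto_upperbound[OF tendsto_norm[OF lim[of f]] eventually_mono[OF filter_leD[OF G(2) F] bd] G(1)] .
  have "bounded_linear g"
  proof (rule bounded_linear_intro[where K = 1])
    show "g (f + f') = g f + g f'" for f f'
      using tendsto_unique[OF G(1) lim[of "f + f'"]] tendsto_add[OF lim[of f] lim[of f']]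
      by (simp add: blinfun.add_left)
    show "g (r *\<^sub>R f) = r *\<^sub>R g f" for r f
      using tendsto_unique[OF G(1) lim[of "r *\<^sub>R f"]] tendsto_scaleR[OF tendsto_const lim[of f]]
      by (simp add: blinfun.scaleR_left)
    show "norm (g f) \<le> norm f * 1" for f using le by simp
  qed
  then have app: "blinfun_apply (Blinfun g) = g"
    by (rule bounded_linear_Blinfun_apply)
  have "norm (Blinfun g) \<le> 1"
    by (rule norm_blinfun_bound) (use le in \<open>auto simp: app\<close>)
  with G lim show ?thesis
    using that[of G "Blinfun g"] by (simp add: app)
qed

text \<open>The compact sets are now discs in the complex plane, and complex homogeneity also passes
  to the limit.\<close>

lemma bidual_cluster_pointC:
  fixes F :: "'a::complex_normed_vector filter"
  assumes "F \<noteq> bot" "F \<le> principal (cball 0 1)"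
  obtains G and z :: "('a \<Rightarrow>\<^sub>C\<^sub>L complex) \<Rightarrow>\<^sub>C\<^sub>L complex" where "G \<noteq> bot" "G \<le> F" "norm z \<le> 1"
    "\<And>f. ((\<lambda>x. cblinfun_apply f x) \<longlongrightarrow> z f) G"
proof -
  have F: "eventually (\<lambda>x. norm x \<le> 1) F"
    using assms(2) by (simp add: le_principal)
  have bd: "norm (cblinfun_apply f x) \<le> norm f" if "norm x \<le> 1" for f :: "'a \<Rightarrow>\<^sub>C\<^sub>L complex" and x
    using norm_cblinfun[of f x] mult_left_le[OF that norm_ge_zero[of f]] by linarith
  have "eventually (\<lambda>x. \<forall>f::'a \<Rightarrow>\<^sub>C\<^sub>L complex. cblinfun_apply f x \<in> cball 0 (norm f)) F"
    using F by eventually_elim (use bd in auto)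
  then obtain G g where G: "G \<noteq> bot" "G \<le> F"
      and lim: "\<And>f::'a \<Rightarrow>\<^sub>C\<^sub>L complex. ((\<lambda>x. cblinfun_apply f x) \<longlongrightarrow> g f) G"
    using pointwise_cluster_point[OF assms(1), of "\<lambda>f::'a \<Rightarrow>\<^sub>C\<^sub>L complex. cball 0 (norm f)" "\<lambda>x f. cblinfun_apply f x"]
    by auto
  have le: "norm (g f) \<le> norm f" for f
    using tendsto_upperbound[OF tendsto_norm[OF lim[of f]] eventually_mono[OF filter_leD[OF G(2) F] bd] G(1)] .
  have "bounded_linear g"
  proof (rule bounded_linear_intro[where K = 1])
    show "g (f + f') = g f + g f'" for f f'
      using tendsto_unique[OF G(1) lim[of "f + f'"]] tendsto_add[OF lim[of f] lim[of f']]
      by (simp add: cblinfun_apply_add_left)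
    show "g (r *\<^sub>R f) = r *\<^sub>R g f" for r f
      using tendsto_unique[OF G(1) lim[of "r *\<^sub>R f"]] tendsto_scaleR[OF tendsto_const lim[of f]]
      by (simp add: cblinfun_apply_scaleR_left)
    show "norm (g f) \<le> norm f * 1" for f using le by simp
  qed
  moreover have "g (c *\<^sub>C f) = c *\<^sub>C g f" for c f
    using tendsto_unique[OF G(1) lim[of "c *\<^sub>C f"]] tendsto_mult[OF tendsto_const lim[of f]]
    by (simp add: cblinfun_apply_scaleC_left scaleC_complex_def)
  ultimately have app: "cblinfun_apply (CBlinfun g) = g"
    by (rule cblinfun_apply_CBlinfun)
  have "norm (CBlinfun g) \<le> 1"
    by (rule norm_cblinfun_bound) (use le in \<open>auto simp: app\<close>)
  with G lim show ?thesis
    using that[of G "CBlinfun g"] by (simp add: app)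
qed

section \<open>Goldstine's theorem by separation in finitely many coordinates\<close>

section \<open>Local weak-star density of the unit ball in the bidual\<close>

text \<open>
  The separating functional is the inner product with a point of the image that nearly minimises
  the distance to the origin.
\<close>

lemma separation_from_origin:
  fixes G :: "'a::real_vector \<Rightarrow> 'i \<Rightarrow> 'k::real_inner"
  assumes "finite I" "convex B" "B \<noteq> {}"
    and affine: "\<And>x w t i. \<lbrakk>x \<in> B; w \<in> B; i \<in> I; 0 \<le> t; t \<le> 1\<rbrakk> \<Longrightarrow>
        G ((1 - t) *\<^sub>R x + t *\<^sub>R w) i = (1 - t) *\<^sub>R G x i + t *\<^sub>R G w i"
    and bounded: "\<And>x i. x \<in> B \<Longrightarrow> i \<in> I \<Longrightarrow> norm (G x i) \<le> M i"
    and "0 < e" and far: "\<And>x. x \<in> B \<Longrightarrow> \<exists>i\<in>I. e \<le> norm (G x i)"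
  obtains a d where "0 < d" "\<And>x. x \<in> B \<Longrightarrow> d \<le> (\<Sum>i\<in>I. inner (a i) (G x i))"
proof -
  \<comment> \<open>\<open>P\<close> is the inner product of the Hilbert sum over \<open>I\<close>,
    so \<open>D\<close> is the squared distance from the image of \<open>B\<close> to the origin,
    and \<open>R\<close> bounds the squared norms in the image.\<close>
  define P where "P x w = (\<Sum>i\<in>I. inner (G x i) (G w i))" for x w
  define R where "R = (\<Sum>i\<in>I. (M i)\<^sup>2)"
  define D where "D = (INF x\<in>B. P x x)"
  have Q: "P x x = (\<Sum>i\<in>I. (norm (G x i))\<^sup>2)" for x
    by (simp add: P_def power2_norm_eq_inner)
  have upper: "P x x \<le> R" if "x \<in> B" for x
    unfolding Q R_def using bounded that by (intro sum_mono power_mono) auto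
  have lower: "D \<le> P x x" if "x \<in> B" for x
    unfolding D_def by (rule cINF_lower[OF _ that], rule bdd_belowI2[of _ 0]) (simp add: Q sum_nonneg)
  \<comment> \<open>One coordinate of norm at least \<open>e\<close> already forces this, so
    \<open>D\<close> is positive.\<close>
  have "e\<^sup>2 \<le> P x x" if "x \<in> B" for x
  proof -
    obtain i where i: "i \<in> I" "e \<le> norm (G x i)"
      using far \<open>x \<in> B\<close> by blast
    then have "e\<^sup>2 \<le> (norm (G x i))\<^sup>2"
      using \<open>0 < e\<close> by (intro power_mono) auto
    also have "\<dots> \<le> P x x"
      unfolding Q using i \<open>finite I\<close> by (intro member_le_sum) auto
    finally show ?thesis .
  qed
  then have "e\<^sup>2 \<le> D"
    unfolding D_def using \<open>B \<noteq> {}\<close> by (intro cINF_greatest)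
  moreover have "0 < e\<^sup>2" using \<open>0 < e\<close> by simp
  ultimately have D: "0 < D" by linarith
  have "D \<le> R"
    using \<open>B \<noteq> {}\<close> lower upper by (meson all_not_in_conv order_trans)
  \<comment> \<open>This makes \<open>t\<^sup>2 * R\<close> equal to \<open>t * D / 3\<close>, and
    the near-minimiser chosen next is allowed the same slack; together the two errors stay below the
    decrease \<open>t * D\<close> of the main terms.\<close>
  define t where "t = D / (3 * R)"
  have t: "0 < t" "t \<le> 1" "t * R = D / 3"
    using D \<open>D \<le> R\<close> by (auto simp: t_def field_simps)
  obtain x where x: "x \<in> B" "P x x < D + t * D / 3"
  proof -
    have "\<exists>x\<in>B. P x x < D + t * D / 3"
    proof (rule ccontr)
      assume "\<not> ?thesis"
      then have "D + t * D / 3 \<le> D"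
        unfolding D_def using \<open>B \<noteq> {}\<close> by (intro cINF_greatest) (auto simp: D_def not_less)
      moreover have "0 < t * D" using t D by simp
      ultimately show False by simp
    qed
    then show ?thesis using that by blast
  qed
  \<comment> \<open>Otherwise moving the fraction \<open>t\<close> of the way from \<open>x\<close>
    to \<open>w\<close> would bring the squared norm below \<open>D\<close>, since the main terms
    would contribute at most \<open>(1 - t) * D\<close>.\<close>
  have "D / 2 \<le> P x w" if w: "w \<in> B" for w
  proof (rule ccontr)
    assume "\<not> D / 2 \<le> P x w"
    then have Pxw: "P x w < D / 2" by simp
    let ?v = "(1 - t) *\<^sub>R x + t *\<^sub>R w"
    have v: "?v \<in> B"
      using convexD[OF \<open>convex B\<close> x(1) w, of "1 - t" t] t by simp
    have "P ?v ?v = (1 - t)\<^sup>2 * P x x + (2 * t * (1 - t)) * P x w + t\<^sup>2 * P w w"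
      unfolding P_def sum_distrib_left sum.distrib[symmetric]
    proof (rule sum.cong)
      fix i assume "i \<in> I"
      then have "G ?v i = (1 - t) *\<^sub>R G x i + t *\<^sub>R G w i"
        using affine x(1) w t by simp
      then show "inner (G ?v i) (G ?v i) = (1 - t)\<^sup>2 * inner (G x i) (G x i)
          + (2 * t * (1 - t)) * inner (G x i) (G w i) + t\<^sup>2 * inner (G w i) (G w i)"
        by (simp add: inner_add_left inner_add_right inner_commute)
          (simp add: power2_eq_square algebra_simps)
    qed simp
    moreover have "(1 - t)\<^sup>2 * P x x \<le> (1 - t)\<^sup>2 * D + t * D / 3"
    proof -
      have "(1 - t)\<^sup>2 * P x x \<le> (1 - t)\<^sup>2 * (D + t * D / 3)"
        using x by (intro mult_left_mono) auto
      moreover have "(1 - t)\<^sup>2 * (t * D / 3) \<le> 1 * (t * D / 3)"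
        using t D by (intro mult_right_mono power_le_one) auto
      ultimately show ?thesis by (simp add: distrib_left)
    qed
    moreover have "(2 * t * (1 - t)) * P x w \<le> (2 * t * (1 - t)) * (D / 2)"
      using Pxw t by (intro mult_left_mono) auto
    moreover have "t\<^sup>2 * P w w \<le> t * (D / 3)"
    proof -
      have "t\<^sup>2 * P w w \<le> t\<^sup>2 * R"
        using upper[OF w] by (intro mult_left_mono) auto
      then show ?thesis
        using t(3) by (simp add: power2_eq_square mult.assoc)
    qed
    ultimately have "D \<le> (1 - t)\<^sup>2 * D + t * D / 3 + (2 * t * (1 - t)) * (D / 2) + t * (D / 3)"
      using lower[OF v] by linarith
    then have "t * D \<le> 0"
      by (simp add: power2_eq_square algebra_simps)
    moreover have "0 < t * D" using t D by simp
    ultimately show False by linarith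
  qed
  then show ?thesis
    using D by (intro that[of "D / 2" "G x"]) (auto simp: P_def)
qed

text \<open>If no point of the ball approximates \<open>z\<close> on \<open>I\<close>, separation
  yields a combination \<open>\<phi>\<close> of the functionals in \<open>I\<close> with
  \<open>\<phi> x \<le> z \<phi> - d \<le> norm \<phi> - d\<close> on the ball, contradicting the
  definition of the operator norm.\<close>

lemma bidual_ball_approximationR:
  fixes z :: "('a::real_normed_vector \<Rightarrow>\<^sub>L real) \<Rightarrow>\<^sub>L real"
  assumes z: "norm z \<le> 1" and I: "finite I" and e: "0 < e"
  shows "\<exists>x\<in>cball 0 1. \<forall>f\<in>I. dist (blinfun_apply f x) (z f) < e"
proof (rule ccontr)
  assume "\<not> ?thesis"
  then have far: "\<exists>f\<in>I. e \<le> norm (blinfun_apply f x - z f)" if "x \<in> cball 0 1" for x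
    using that by (auto simp: dist_norm not_less)
  obtain a d where d: "0 < d"
    and sep: "\<And>x. x \<in> cball 0 1 \<Longrightarrow> d \<le> (\<Sum>f\<in>I. inner (a f) (blinfun_apply f x - z f))"
  proof (rule separation_from_origin[where B = "cball 0 1" and I = I and e = e
        and G = "\<lambda>x f. blinfun_apply f x - z f" and M = "\<lambda>f. norm f + norm (z f)"])
    fix x :: 'a and f :: "'a \<Rightarrow>\<^sub>L real" assume "x \<in> cball 0 1"
    then have "norm (blinfun_apply f x) \<le> norm f"
      using norm_blinfun[of f x] mult_left_le[of "norm x" "norm f"] by auto
    then show "norm (blinfun_apply f x - z f) \<le> norm f + norm (z f)"
      using norm_triangle_ineq4[of "blinfun_apply f x" "z f"] by linarith
    show "blinfun_apply f ((1 - t) *\<^sub>R x + t *\<^sub>R w) - z f =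
        (1 - t) *\<^sub>R (blinfun_apply f x - z f) + t *\<^sub>R (blinfun_apply f w - z f)" for x w t f
      by (simp add: blinfun.add_right blinfun.scaleR_right) (simp add: algebra_simps)
  qed (use I e far in auto)
  \<comment> \<open>The sign makes the separating sum equal to
    \<open>z \<phi> - \<phi> x\<close>.\<close>
  define \<phi> where "\<phi> = - (\<Sum>f\<in>I. a f *\<^sub>R f)"
  have z\<phi>: "z \<phi> = - (\<Sum>f\<in>I. a f * z f)"
    by (simp add: \<phi>_def blinfun.minus_right blinfun.sum_right blinfun.scaleR_right)
  have \<phi>: "blinfun_apply \<phi> x = - (\<Sum>f\<in>I. a f * blinfun_apply f x)" for x
    by (simp add: \<phi>_def blinfun.minus_left blinfun.sum_left blinfun.scaleR_left)
  have "z \<phi> \<le> norm \<phi>"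
    using norm_blinfun[of z \<phi>] mult_right_mono[OF z norm_ge_zero[of \<phi>]] by simp
  then have le: "blinfun_apply \<phi> x \<le> norm \<phi> - d" if "norm x \<le> 1" for x
    using sep[of x] that by (simp add: \<phi> z\<phi> algebra_simps sum_subtractf)
  have bound: "norm (blinfun_apply \<phi> x) \<le> (norm \<phi> - d) * norm x" for x
  proof (cases "x = 0")
    case False
    \<comment> \<open>Rescaling to \<open>sgn x\<close> extends the bound from the ball to every
      vector; applying it to \<open>- x\<close> too bounds the absolute value.\<close>
    have "blinfun_apply \<phi> x \<le> (norm \<phi> - d) * norm x" if "x \<noteq> 0" for x
      using le[of "sgn x"] that
      by (simp add: norm_sgn sgn_div_norm blinfun.scaleR_right field_simps)
    from this[of x] this[of "- x"] False show ?thesis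
      by (simp add: blinfun.minus_right)
  qed simp
  moreover have "0 \<le> norm \<phi> - d"
    using le[of 0] by simp
  ultimately have "norm \<phi> \<le> norm \<phi> - d"
    by (intro norm_blinfun_bound)
  with d show False by simp
qed

lemma cblinfun_apply_sum_left:
  "cblinfun_apply (\<Sum>i\<in>I. f i) x = (\<Sum>i\<in>I. cblinfun_apply (f i) x)"
  by (induction I rule: infinite_finite_induct)
    (simp_all add: cblinfun_apply_add_left, (transfer, simp)+)

lemma cblinfun_apply_sum_right:
  "cblinfun_apply f (\<Sum>i\<in>I. x i) = (\<Sum>i\<in>I. cblinfun_apply f (x i))"
  by transfer (rule blinfun.sum_right)

text \<open>Separation only controls the real part of a complex combination; rotating
  \<open>x\<close> by a scalar turns this into a bound on the modulus.\<close>

lemma bidual_ball_approximationC: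
  fixes z :: "('a::complex_normed_vector \<Rightarrow>\<^sub>C\<^sub>L complex) \<Rightarrow>\<^sub>C\<^sub>L complex"
  assumes z: "norm z \<le> 1" and I: "finite I" and e: "0 < e"
  shows "\<exists>x\<in>cball 0 1. \<forall>f\<in>I. dist (cblinfun_apply f x) (z f) < e"
proof (rule ccontr)
  assume "\<not> ?thesis"
  then have far: "\<exists>f\<in>I. e \<le> norm (cblinfun_apply f x - z f)" if "x \<in> cball 0 1" for x
    using that by (auto simp: dist_norm not_less)
  obtain a d where d: "0 < d"
    and sep: "\<And>x. x \<in> cball 0 1 \<Longrightarrow> d \<le> (\<Sum>f\<in>I. inner (a f) (cblinfun_apply f x - z f))"
  proof (rule separation_from_origin[where B = "cball 0 1" and I = I and e = e
        and G = "\<lambda>x f. cblinfun_apply f x - z f" and M = "\<lambda>f. norm f + norm (z f)"])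
    fix x :: 'a and f :: "'a \<Rightarrow>\<^sub>C\<^sub>L complex" assume "x \<in> cball 0 1"
    then have "norm (cblinfun_apply f x) \<le> norm f"
      using norm_cblinfun[of f x] mult_left_le[of "norm x" "norm f"] by auto
    then show "norm (cblinfun_apply f x - z f) \<le> norm f + norm (z f)"
      using norm_triangle_ineq4[of "cblinfun_apply f x" "z f"] by linarith
    show "cblinfun_apply f ((1 - t) *\<^sub>R x + t *\<^sub>R w) - z f =
        (1 - t) *\<^sub>R (cblinfun_apply f x - z f) + t *\<^sub>R (cblinfun_apply f w - z f)" for x w t f
      by (simp add: cblinfun_apply_add_right cblinfun_apply_scaleR_right) (simp add: algebra_simps)
  qed (use I e far in auto)
  \<comment> \<open>The real inner product on the complex numbers is \<open>Re (cnj v * w)\<close>,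
    which forces conjugated coefficients.\<close>
  define \<phi> where "\<phi> = (\<Sum>f\<in>I. (- cnj (a f)) *\<^sub>C f)"
  have z\<phi>: "z \<phi> = (\<Sum>f\<in>I. - cnj (a f) * z f)"
    by (simp add: \<phi>_def cblinfun_apply_sum_right cblinfun_apply_scaleC scaleC_complex_def)
  have \<phi>: "cblinfun_apply \<phi> x = (\<Sum>f\<in>I. - cnj (a f) * cblinfun_apply f x)" for x
    by (simp add: \<phi>_def cblinfun_apply_sum_left cblinfun_apply_scaleC_left scaleC_complex_def)
  have inner_eq: "inner v w = Re (cnj v * w)" for v w
    by (simp add: inner_complex_def)
  have "Re (z \<phi>) \<le> norm \<phi>"
    using complex_Re_le_cmod[of "z \<phi>"] norm_cblinfun[of z \<phi>]
      mult_right_mono[OF z norm_ge_zero[of \<phi>]] by simp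
  moreover have "(\<Sum>f\<in>I. inner (a f) (cblinfun_apply f x - z f)) = Re (z \<phi>) - Re (cblinfun_apply \<phi> x)" for x
    by (simp add: inner_eq \<phi> z\<phi> sum_subtractf[symmetric] sum_negf[symmetric] algebra_simps del: sum_subtractf sum_negf)
  ultimately have le: "Re (cblinfun_apply \<phi> x) \<le> norm \<phi> - d" if "norm x \<le> 1" for x
    using sep[of x] that by simp
  have bound: "norm (cblinfun_apply \<phi> x) \<le> (norm \<phi> - d) * norm x" for x
  proof (cases "x = 0 \<or> cblinfun_apply \<phi> x = 0")
    case False
    \<comment> \<open>\<open>c\<close> normalises \<open>x\<close> and cancels the argument of
      \<open>\<phi> x\<close>, so the value at the scaled vector is the real number
      \<open>norm (\<phi> x) / norm x\<close>.\<close>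
    define c where "c = cnj (sgn (cblinfun_apply \<phi> x)) / norm x"
    have "norm (c *\<^sub>C x) = 1"
      using False by (simp add: c_def norm_scaleC norm_divide norm_sgn)
    moreover have "cblinfun_apply \<phi> (c *\<^sub>C x) = norm (cblinfun_apply \<phi> x) / norm x"
      using False complex_norm_square[of "cblinfun_apply \<phi> x"]
      by (simp add: c_def cblinfun_apply_scaleC scaleC_complex_def sgn_div_norm
          scaleR_conv_of_real field_simps power2_eq_square)
    ultimately have "norm (cblinfun_apply \<phi> x) / norm x \<le> norm \<phi> - d"
      using le[of "c *\<^sub>C x"] by simp
    then show ?thesis
      using False by (simp add: field_simps)
  next
    case True
    have "0 \<le> norm \<phi> - d"
      using le[of 0] norm_cblinfun[of \<phi> 0] by simp
    with True norm_cblinfun[of \<phi> 0] show ?thesis by auto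
  qed
  moreover have "0 \<le> norm \<phi> - d"
    using le[of 0] norm_cblinfun[of \<phi> 0] by simp
  ultimately have "norm \<phi> \<le> norm \<phi> - d"
    by (intro norm_cblinfun_bound)
  with d show False by simp
qed

section \<open>Norm estimates for the biadjoint and both directions of the equivalence\<close>

section \<open>The equivalence\<close>

lemma norm_adjointR: "norm (adjointR T) \<le> norm T"
  by (rule norm_blinfun_bound)
    (simp_all add: adjointR_apply norm_blinfun_compose[THEN order_trans] mult.commute)

lemma norm_adjointC: "norm (adjointC T) \<le> norm T"
  by (rule norm_cblinfun_bound)
    (simp_all add: adjointC_apply norm_cblinfun_compose[THEN order_trans] mult.commute)

lemma norm_canonR: "norm (canonR :: 'a::real_normed_vector \<Rightarrow>\<^sub>L _) \<le> 1"
proof (rule norm_blinfun_bound)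
  show "norm (blinfun_apply canonR x) \<le> 1 * norm x" for x :: 'a
    by (rule norm_blinfun_bound) (use norm_blinfun[of "_ :: 'a \<Rightarrow>\<^sub>L real" x] in \<open>auto simp: canonR_apply mult.commute\<close>)
qed simp

lemma norm_canonC: "norm (canonC :: 'a::complex_normed_vector \<Rightarrow>\<^sub>C\<^sub>L _) \<le> 1"
proof (rule norm_cblinfun_bound)
  show "norm (cblinfun_apply canonC x) \<le> 1 * norm x" for x :: 'a
    by (rule norm_cblinfun_bound) (use norm_cblinfun[of "_ :: 'a \<Rightarrow>\<^sub>C\<^sub>L complex" x] in \<open>auto simp: canonC_apply mult.commute\<close>)
qed simp

lemma norm_restrictR:
  fixes \<Phi> :: "(('a::real_normed_vector \<Rightarrow>\<^sub>L real) \<Rightarrow>\<^sub>L real) \<Rightarrow>\<^sub>L real"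
  shows "norm (restrictR \<Phi>) \<le> norm \<Phi>"
  using norm_blinfun_compose[of \<Phi> canonR] mult_left_le[OF norm_canonR[where 'a='a] norm_ge_zero[of \<Phi>]]
  by (simp add: restrictR_def)

lemma norm_restrictC:
  fixes \<Phi> :: "(('a::complex_normed_vector \<Rightarrow>\<^sub>C\<^sub>L complex) \<Rightarrow>\<^sub>C\<^sub>L complex) \<Rightarrow>\<^sub>C\<^sub>L complex"
  shows "norm (restrictC \<Phi>) \<le> norm \<Phi>"
  using norm_cblinfun_compose[of \<Phi> canonC] mult_left_le[OF norm_canonC[where 'a='a] norm_ge_zero[of \<Phi>]]
  by (simp add: restrictC_def)

lemma restrict_biadjointR_apply:
  "blinfun_apply (restrictR (adjointR (adjointR T) z)) y = z (adjointR T (canonR y))"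
  by (simp add: restrictR_def adjointR_apply)

lemma restrict_biadjointC_apply:
  "cblinfun_apply (restrictC (adjointC (adjointC T) z)) y = z (adjointC T (canonC y))"
  by (simp add: restrictC_def adjointC_apply)

lemma adjointR_canonR_apply: "blinfun_apply (adjointR T (canonR y)) x = T x y"
  by (simp add: adjointR_apply canonR_apply)

lemma adjointC_canonC_apply: "cblinfun_apply (adjointC T (canonC y)) x = T x y"
  by (simp add: adjointC_apply canonC_apply)

text \<open>Serves the case \<open>T = 0\<close>, where a weak-star cluster point may have norm
  below 1. A norming functional shows that the canonical image of \<open>x0\<close> is
  nonzero.\<close>

lemma exists_unit_bidualR:
  assumes "(UNIV :: 'a::real_normed_vector set) \<noteq> {0}"
  shows "\<exists>z :: ('a \<Rightarrow>\<^sub>L real) \<Rightarrow>\<^sub>L real. norm z = 1"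
proof -
  obtain x0 :: 'a where x0: "x0 \<noteq> 0" using assms by blast
  obtain f :: "'a \<Rightarrow>\<^sub>L real" where "f x0 = norm x0"
    using exists_norming_functional by blast
  then have "blinfun_apply (canonR x0) f \<noteq> 0"
    using x0 by (simp add: canonR_apply)
  then have "canonR x0 \<noteq> 0" by auto
  then show ?thesis
    by (intro exI[of _ "sgn (canonR x0)"]) (simp add: norm_sgn)
qed

lemma exists_unit_bidualC:
  assumes "(UNIV :: 'a::complex_normed_vector set) \<noteq> {0}"
  shows "\<exists>z :: ('a \<Rightarrow>\<^sub>C\<^sub>L complex) \<Rightarrow>\<^sub>C\<^sub>L complex. norm z = 1"
proof -
  obtain x0 :: 'a where x0: "x0 \<noteq> 0" using assms by blast
  obtain f :: "'a \<Rightarrow>\<^sub>C\<^sub>L complex" where "f x0 \<noteq> 0"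
    using exists_functional_nonzeroC[OF x0] by blast
  then have "cblinfun_apply (canonC x0) f \<noteq> 0"
    by (simp add: canonC_apply)
  then have "canonC x0 \<noteq> 0"
    using norm_cblinfun[of "canonC x0" f] by auto
  then show ?thesis
    by (intro exI[of _ "sgn (canonC x0)"]) (simp add: norm_sgn)
qed

lemma attains_norm_biadjointR:
  fixes T :: "'a::real_normed_vector \<Rightarrow>\<^sub>L ('b::real_normed_vector \<Rightarrow>\<^sub>L real)"
  assumes "norm z \<le> 1" "norm (restrictR (adjointR (adjointR T) z)) = norm T"
  shows "attains_norm_atR (adjointR (adjointR T)) z" "T \<noteq> 0 \<Longrightarrow> norm z = 1"
proof -
  let ?A = "adjointR (adjointR T)"
  have "norm T \<le> norm (?A z)"
    using norm_restrictR[of "?A z"] assms(2) by simp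
  moreover have A: "norm ?A \<le> norm T"
    using norm_adjointR[of "adjointR T"] norm_adjointR[of T] by simp
  moreover have "norm (?A z) \<le> norm ?A * norm z"
    by (rule norm_blinfun)
  moreover have "norm ?A * norm z \<le> norm ?A"
    using assms(1) by (simp add: mult_left_le)
  moreover have "norm ?A * norm z \<le> norm T * norm z"
    using A by (rule mult_right_mono) simp
  \<comment> \<open>The inequalities run from \<open>norm T\<close> back to \<open>norm T\<close>,
    so the norm is attained even for \<open>T = 0\<close>; only \<open>norm z = 1\<close> requires
    cancelling \<open>norm T\<close>.\<close>
  ultimately have eq: "norm (?A z) = norm ?A" and le: "norm T * 1 \<le> norm T * norm z"
    by linarith+
  show "attains_norm_atR ?A z"
    using eq assms(1) by (simp add: attains_norm_atR_def)
  show "norm z = 1" if "T \<noteq> 0"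
    using le assms(1) that mult_le_cancel_left_pos[of "norm T" 1 "norm z"] by simp
qed

lemma attains_norm_biadjointC:
  fixes T :: "'a::complex_normed_vector \<Rightarrow>\<^sub>C\<^sub>L ('b::complex_normed_vector \<Rightarrow>\<^sub>C\<^sub>L complex)"
  assumes "norm z \<le> 1" "norm (restrictC (adjointC (adjointC T) z)) = norm T"
  shows "attains_norm_atC (adjointC (adjointC T)) z" "T \<noteq> 0 \<Longrightarrow> norm z = 1"
proof -
  let ?A = "adjointC (adjointC T)"
  have "norm T \<le> norm (?A z)"
    using norm_restrictC[of "?A z"] assms(2) by simp
  moreover have A: "norm ?A \<le> norm T"
    using norm_adjointC[of "adjointC T"] norm_adjointC[of T] by simp
  moreover have "norm (?A z) \<le> norm ?A * norm z"
    by (rule norm_cblinfun)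
  moreover have "norm ?A * norm z \<le> norm ?A"
    using assms(1) by (simp add: mult_left_le)
  moreover have "norm ?A * norm z \<le> norm T * norm z"
    using A by (rule mult_right_mono) simp
  ultimately have eq: "norm (?A z) = norm ?A" and le: "norm T * 1 \<le> norm T * norm z"
    by linarith+
  show "attains_norm_atC ?A z"
    using eq assms(1) by (simp add: attains_norm_atC_def)
  show "norm z = 1" if "T \<noteq> 0"
    using le assms(1) that mult_le_cancel_left_pos[of "norm T" 1 "norm z"] by simp
qed

lemma wstar_QNA_R_iff:
  fixes T :: "'a::real_normed_vector \<Rightarrow>\<^sub>L ('b::real_normed_vector \<Rightarrow>\<^sub>L real)"
  assumes "(UNIV :: 'a set) \<noteq> {0}"
  shows "T \<in> wstar_QNA_R \<longleftrightarrow>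
    (\<exists>z \<in> sphere 0 1. attains_norm_atR (adjointR (adjointR T)) z \<and>
      norm (restrictR (adjointR (adjointR T) z)) = norm T)" (is "_ \<longleftrightarrow> ?attains")
proof
  assume "T \<in> wstar_QNA_R"
  then obtain F and u :: "'b \<Rightarrow>\<^sub>L real" where F: "F \<noteq> bot" "F \<le> principal (cball 0 1)" "norm u = norm T"
    and Tu: "\<And>y. ((\<lambda>x. T x y) \<longlongrightarrow> u y) F"
    unfolding wstar_QNA_R_def weak_starR_def limitin_pullback_pointwise_iff by blast
  obtain G and z :: "('a \<Rightarrow>\<^sub>L real) \<Rightarrow>\<^sub>L real"
    where G: "G \<noteq> bot" "G \<le> F" and z: "norm z \<le> 1"
      "\<And>f. ((\<lambda>x. blinfun_apply f x) \<longlongrightarrow> blinfun_apply z f) G"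
    using bidual_cluster_pointR[OF F(1,2)] by blast
  \<comment> \<open>Along the subnet \<open>G\<close>, \<open>T x y\<close> tends both to
    \<open>u y\<close> and to \<open>z (adjointR T (canonR y))\<close>.\<close>
  have "restrictR (adjointR (adjointR T) z) = u"
  proof (rule blinfun_eqI)
    fix y
    have "((\<lambda>x. T x y) \<longlongrightarrow> z (adjointR T (canonR y))) G"
      using z(2)[of "adjointR T (canonR y)"] by (simp add: adjointR_canonR_apply)
    then show "blinfun_apply (restrictR (adjointR (adjointR T) z)) y = u y"
      using tendsto_unique[OF G(1) _ tendsto_mono[OF G(2) Tu]] by (simp add: restrict_biadjointR_apply)
  qed
  then have eq: "norm (restrictR (adjointR (adjointR T) z)) = norm T"
    using F(3) by simp
  show ?attains
  proof (cases "T = 0")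
    case True
    \<comment> \<open>\<open>z\<close> may lie inside the ball here, but every restriction is zero,
      so any unit vector serves.\<close>
    obtain w :: "('a \<Rightarrow>\<^sub>L real) \<Rightarrow>\<^sub>L real" where w: "norm w = 1"
      using exists_unit_bidualR[OF assms] by blast
    have "norm (restrictR (adjointR (adjointR T) w)) = norm T"
    proof -
      have "norm (adjointR (adjointR T)) \<le> 0"
        using norm_adjointR[of "adjointR T"] norm_adjointR[of T] True by simp
      then show ?thesis
        using norm_restrictR[of "adjointR (adjointR T) w"] True by simp
    qed
    then show ?thesis
      using attains_norm_biadjointR(1)[of w T] w by (intro bexI[of _ w]) auto
  next
    case False
    then show ?thesis
      using attains_norm_biadjointR[OF z(1) eq] eq by (intro bexI[of _ z]) auto
  qed
next
  assume ?attains
  then obtain z where z: "norm z = 1" "norm (restrictR (adjointR (adjointR T) z)) = norm T"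
    by auto
  let ?u = "restrictR (adjointR (adjointR T) z)"
  \<comment> \<open>Finitely many \<open>y\<close> give finitely many functionals
    \<open>adjointR T (canonR y)\<close>, on which \<open>z\<close> is approximated by points of the
    ball.\<close>
  have "\<exists>x\<in>cball 0 1. \<forall>y\<in>I. dist (T x y) (?u y) < e" if "finite I" "0 < e" for I e
    using bidual_ball_approximationR[of z "(\<lambda>y. adjointR T (canonR y)) ` I" e] that z(1)
    by (simp add: adjointR_canonR_apply restrict_biadjointR_apply)
  then have "\<exists>F. F \<noteq> bot \<and> F \<le> principal (cball 0 1) \<and> (\<forall>y. ((\<lambda>x. T x y) \<longlongrightarrow> ?u y) F)"
    by (rule exists_filter_pointwise_limit)
  with z(2) show "T \<in> wstar_QNA_R"
    unfolding wstar_QNA_R_def weak_starR_def limitin_pullback_pointwise_iff by blast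
qed

lemma wstar_QNA_C_iff:
  fixes T :: "'a::complex_normed_vector \<Rightarrow>\<^sub>C\<^sub>L ('b::complex_normed_vector \<Rightarrow>\<^sub>C\<^sub>L complex)"
  assumes "(UNIV :: 'a set) \<noteq> {0}"
  shows "T \<in> wstar_QNA_C \<longleftrightarrow>
    (\<exists>z \<in> sphere 0 1. attains_norm_atC (adjointC (adjointC T)) z \<and>
      norm (restrictC (adjointC (adjointC T) z)) = norm T)" (is "_ \<longleftrightarrow> ?attains")
proof
  assume "T \<in> wstar_QNA_C"
  then obtain F and u :: "'b \<Rightarrow>\<^sub>C\<^sub>L complex" where F: "F \<noteq> bot" "F \<le> principal (cball 0 1)" "norm u = norm T"
    and Tu: "\<And>y. ((\<lambda>x. T x y) \<longlongrightarrow> u y) F"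
    unfolding wstar_QNA_C_def weak_starC_def limitin_pullback_pointwise_iff by blast
  obtain G and z :: "('a \<Rightarrow>\<^sub>C\<^sub>L complex) \<Rightarrow>\<^sub>C\<^sub>L complex"
    where G: "G \<noteq> bot" "G \<le> F" and z: "norm z \<le> 1"
      "\<And>f. ((\<lambda>x. cblinfun_apply f x) \<longlongrightarrow> cblinfun_apply z f) G"
    using bidual_cluster_pointC[OF F(1,2)] by blast
  have "restrictC (adjointC (adjointC T) z) = u"
  proof (rule cblinfun_eqI)
    fix y
    have "((\<lambda>x. T x y) \<longlongrightarrow> z (adjointC T (canonC y))) G"
      using z(2)[of "adjointC T (canonC y)"] by (simp add: adjointC_canonC_apply)
    then show "cblinfun_apply (restrictC (adjointC (adjointC T) z)) y = u y"
      using tendsto_unique[OF G(1) _ tendsto_mono[OF G(2) Tu]] by (simp add: restrict_biadjointC_apply)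
  qed
  then have eq: "norm (restrictC (adjointC (adjointC T) z)) = norm T"
    using F(3) by simp
  show ?attains
  proof (cases "T = 0")
    case True
    obtain w :: "('a \<Rightarrow>\<^sub>C\<^sub>L complex) \<Rightarrow>\<^sub>C\<^sub>L complex" where w: "norm w = 1"
      using exists_unit_bidualC[OF assms] by blast
    have "norm (restrictC (adjointC (adjointC T) w)) = norm T"
    proof -
      have "norm (adjointC (adjointC T)) \<le> 0"
        using norm_adjointC[of "adjointC T"] norm_adjointC[of T] True by simp
      then show ?thesis
        using norm_restrictC[of "adjointC (adjointC T) w"] norm_cblinfun[of "adjointC (adjointC T)" w] True
        by simp
    qed
    then show ?thesis
      using attains_norm_biadjointC(1)[of w T] w by (intro bexI[of _ w]) auto
  next
    case False
    then show ?thesis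
      using attains_norm_biadjointC[OF z(1) eq] eq by (intro bexI[of _ z]) auto
  qed
next
  assume ?attains
  then obtain z where z: "norm z = 1" "norm (restrictC (adjointC (adjointC T) z)) = norm T"
    by auto
  let ?u = "restrictC (adjointC (adjointC T) z)"
  have "\<exists>x\<in>cball 0 1. \<forall>y\<in>I. dist (T x y) (?u y) < e" if "finite I" "0 < e" for I e
    using bidual_ball_approximationC[of z "(\<lambda>y. adjointC T (canonC y)) ` I" e] that z(1)
    by (simp add: adjointC_canonC_apply restrict_biadjointC_apply)
  then have "\<exists>F. F \<noteq> bot \<and> F \<le> principal (cball 0 1) \<and> (\<forall>y. ((\<lambda>x. T x y) \<longlongrightarrow> ?u y) F)"
    by (rule exists_filter_pointwise_limit)
  with z(2) show "T \<in> wstar_QNA_C"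
    unfolding wstar_QNA_C_def weak_starC_def limitin_pullback_pointwise_iff by blast
qed

text \<open>For a zero domain the unit sphere of the bidual is empty, so (b) fails although the zero
  operator satisfies (a); hence the assumption in each half.\<close>

theorem proposition3p1:
  fixes S :: "'x::banach \<Rightarrow>\<^sub>L ('y::banach \<Rightarrow>\<^sub>L real)"
    and T :: "'u::complex_banach \<Rightarrow>\<^sub>C\<^sub>L ('v::complex_banach \<Rightarrow>\<^sub>C\<^sub>L complex)"
  shows "((UNIV :: 'x set) \<noteq> {0} \<longrightarrow>
      (S \<in> wstar_QNA_R \<longleftrightarrow>
        (\<exists>z \<in> sphere 0 1. attains_norm_atR (adjointR (adjointR S)) z \<and>
           norm (restrictR (adjointR (adjointR S) z)) = norm S)))
    \<and> ((UNIV :: 'u set) \<noteq> {0} \<longrightarrow>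
      (T \<in> wstar_QNA_C \<longleftrightarrow>
        (\<exists>z \<in> sphere 0 1. attains_norm_atC (adjointC (adjointC T)) z \<and>
           norm (restrictC (adjointC (adjointC T) z)) = norm T)))"
  using wstar_QNA_R_iff[of S] wstar_QNA_C_iff[of T] by blast

end
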